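(* Fix an integer base $q\ge2$. The automaticity $A(x)$ of the set of prime numbers satisfies \[A(x)=\mathcal{O}\left(\frac{x}{\log x\,\log\log\log x}\right)\] as $x\to\infty$ (the implied constant possibly depending on $q$).
   Context: A finite automaton over an alphabet $\mathcal{A}$ consists of a finite set $S$ of states, a starting state $s_0\in S$, a transition function $\delta:\mathcal{A}\times S\to S$ and a set $T\subseteq S$ of accepting states; a word $a_1\cdots a_n$ induces states $s_0,\dots,s_n$ with $s_{i+1}=\delta(a_{i+1},s_i)$ and is accepted iff $s_n\in T$. With $\mathcal{A}=\{0,1,\dots,q-1\}$, words are identified with nonnegative integers via the base-$q$ representation (in the paper's arguments the digits are read starting from the least significant digit). The automaticity of a set $\mathcal{X}$ of positive integers is the function $A(x)$ giving, for each $x$, the number of states of the smallest automaton which, for every integer $1\le n\le x$, accepts the base-$q$ representation of $n$ if and only if $n\in\mathcal{X}$. *)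

theory Defs
  imports Complex_Main "HOL-Library.Landau_Symbols" "HOL-Library.Countable"
    "HOL-Computational_Algebra.Primes"
begin

record ('a, 's) automaton =
  states :: "'s set"
  start :: 's
  trans :: "'a \<Rightarrow> 's \<Rightarrow> 's"
  accepting :: "'s set"

definition finite_automaton :: "'a set \<Rightarrow> ('a, 's) automaton \<Rightarrow> bool" where
  "finite_automaton A M \<longleftrightarrow>
     finite (states M) \<and> start M \<in> states M \<and>
     (\<forall>a\<in>A. \<forall>s\<in>states M. trans M a s \<in> states M) \<and>
     accepting M \<subseteq> states M"

definition accepts :: "('a, 's) automaton \<Rightarrow> 'a list \<Rightarrow> bool" where
  "accepts M w \<longleftrightarrow> fold (trans M) w (start M) \<in> accepting M"

text \<open>Least significant digit first, without leading zeros. The guard on q only serves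
  termination; 0 is represented by the empty word.\<close>

fun base_rep :: "nat \<Rightarrow> nat \<Rightarrow> nat list" where
  "base_rep q n = (if n = 0 \<or> q < 2 then [] else (n mod q) # base_rep q (n div q))"

declare base_rep.simps [simp del]

definition recognizes_upto ::
    "nat \<Rightarrow> nat set \<Rightarrow> real \<Rightarrow> (nat, 's) automaton \<Rightarrow> bool" where
  "recognizes_upto q X x M \<longleftrightarrow>
     finite_automaton {..<q} M \<and>
     (\<forall>n::nat. 1 \<le> n \<and> real n \<le> x \<longrightarrow> (accepts M (base_rep q n) \<longleftrightarrow> n \<in> X))"

text \<open>Taking the states to be natural numbers is no restriction, as only their number matters.\<close>

definition automaticity :: "nat \<Rightarrow> nat set \<Rightarrow> real \<Rightarrow> nat" where
  "automaticity q X x =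
     (LEAST k. \<exists>M :: (nat, nat) automaton. recognizes_upto q X x M \<and> card (states M) = k)"

lemma horner_sum_base_rep:
  assumes "q \<ge> 2"
  shows "horner_sum (\<lambda>d. d) q (base_rep q n) = n"
  using assms
proof (induction q n rule: base_rep.induct)
  case (1 q n)
  then show ?case by (subst base_rep.simps) auto
qed

lemma set_base_rep: "set (base_rep q n) \<subseteq> {..<q}"
proof (induction q n rule: base_rep.induct)
  case (1 q n)
  then show ?case by (subst base_rep.simps) auto
qed

text \<open>The minimum defining the automaticity is over a nonempty set.\<close>

lemma ex_recognizes_upto:
  assumes q: "q \<ge> 2"
  shows "\<exists>M :: (nat, nat) automaton. recognizes_upto q X x M"
proof -
  define N where "N = {n::nat. real n \<le> x}"
  have "N \<subseteq> {..nat \<lfloor>x\<rfloor>}"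
    unfolding N_def by (auto simp: le_nat_floor)
  then have fN: "finite N"
    using finite_subset by blast
  define L where "L = Max (insert 0 ((\<lambda>n. length (base_rep q n)) ` N))"
  have L: "length (base_rep q n) \<le> L" if "n \<in> N" for n
    unfolding L_def using fN that by (intro Max_ge) auto
  define W where "W = {w. set w \<subseteq> {..<q} \<and> length w \<le> L}"
  have fW: "finite W"
    unfolding W_def by (rule finite_lists_length_le) simp
  define f where "f a c = (let w = from_nat c @ [a] in
    if length w \<le> L then to_nat w else c)" for a c :: nat
  define M :: "(nat, nat) automaton" where
    "M = \<lparr>states = to_nat ` W, start = to_nat ([] :: nat list), trans = f,
      accepting = to_nat ` base_rep q ` (N \<inter> X)\<rparr>"
  have run: "fold f w (to_nat v) = to_nat (v @ w)" if "length (v @ w) \<le> L" for v w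
    using that
  proof (induction w arbitrary: v)
    case (Cons a w)
    from Cons.prems Cons.IH[of "v @ [a]"] show ?case by (simp add: f_def)
  qed simp
  have "finite_automaton {..<q} M"
    using fW L set_base_rep[of q]
    by (auto simp: finite_automaton_def M_def W_def f_def Let_def)
  moreover have "accepts M (base_rep q n) \<longleftrightarrow> n \<in> X" if "real n \<le> x" for n
  proof -
    have n: "n \<in> N"
      using that by (simp add: N_def)
    have "accepts M (base_rep q n) \<longleftrightarrow> base_rep q n \<in> base_rep q ` (N \<inter> X)"
      using run[of "[]" "base_rep q n"] L[OF n] by (auto simp: accepts_def M_def)
    also have "\<dots> \<longleftrightarrow> n \<in> X"
      using n horner_sum_base_rep[OF q] by (metis IntD2 IntI image_iff)
    finally show ?thesis .
  qed
  ultimately show ?thesis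
    unfolding recognizes_upto_def by blast
qed

end

theory Submission
  imports Defs "HOL-Number_Theory.Totient" "HOL-Analysis.Harmonic_Numbers"
    "HOL-Real_Asymp.Real_Asymp"
begin

text \<open>Take the quotients \<open>{m. a + q ^ k * m \<in> Y}\<close> with \<open>a < q ^ k\<close> of the set \<open>Y\<close>
  of primes up to \<open>x\<close> as states, and put \<open>D = 16 q x / (ln x ln ln ln x)\<close>. The levels with
  \<open>q ^ k \<le> D\<close> contribute at most a geometric sum, of size \<open>2 D\<close>. When \<open>q ^ k > D\<close>, let \<open>P\<close>
  be the product of the primes up to \<open>sqrt (ln (ln x))\<close> not dividing \<open>q\<close>. As \<open>q ^ k\<close> is
  invertible modulo \<open>P\<close>, a quotient is, apart from \<open>0\<close>, a subset of the integers
  \<open>m \<le> x / D\<close> with \<open>m + u\<close> coprime to \<open>P\<close>, for one of \<open>P\<close> possible shifts \<open>u\<close>. By a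
  Mertens-type bound there are at most \<open>ln x / 2\<close> such \<open>m\<close>, so all these levels together give
  only \<open>O(sqrt x * ln x)\<close> distinct quotients.\<close>

section \<open>Residuals as states of an automaton\<close>

definition residual :: "nat \<Rightarrow> nat set \<Rightarrow> nat \<Rightarrow> nat \<Rightarrow> nat set" where
  "residual q Y a k = {m. a + q ^ k * m \<in> Y}"

definition residuals :: "nat \<Rightarrow> nat set \<Rightarrow> nat set set" where
  "residuals q Y = {residual q Y a k |a k. a < q ^ k}"

lemma residual_0_0: "residual q Y 0 0 = Y"
  by (simp add: residual_def)

lemma mem_residuals: "Y \<in> residuals q Y"
  unfolding residuals_def using residual_0_0[of q Y, symmetric] by fastforce

text \<open>After \<open>k\<close> digits the next digit \<open>d\<close> has place value
  \<open>q ^ k\<close>, so the value \<open>a\<close> read so far becomes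
  \<open>a + q ^ k * d\<close>, now with \<open>k + 1\<close> digits.\<close>

lemma shift_residual:
  "{m. q * m + d \<in> residual q Y a k} = residual q Y (a + q ^ k * d) (Suc k)"
  by (auto simp: residual_def algebra_simps)

lemma shift_mem_residuals:
  assumes "S \<in> residuals q Y" "d < q"
  shows "{m. q * m + d \<in> S} \<in> residuals q Y"
proof -
  obtain a k where ak: "a < q ^ k" "S = residual q Y a k"
    using assms(1) by (auto simp: residuals_def)
  have "a + q ^ k * d < q ^ k * Suc d"
    using ak by simp
  also have "\<dots> \<le> q ^ k * q"
    using assms(2) by (intro mult_left_mono) auto
  finally have "a + q ^ k * d < q ^ Suc k"
    by (simp add: mult.commute)
  then show ?thesis
    unfolding ak(2) shift_residual residuals_def by blast
qed

lemma zero_mem_fold_shift: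
  "0 \<in> fold (\<lambda>d S. {m. q * m + d \<in> S}) w S \<longleftrightarrow> horner_sum (\<lambda>d. d) q w \<in> S"
  by (induction w arbitrary: S) (auto simp: algebra_simps)

text \<open>Myhill-Nerode construction: a state is the set of numbers whose digits may still follow.
  Reading \<open>d\<close> replaces \<open>S\<close> by \<open>{m. q * m + d \<in> S}\<close>, and a
  state accepts iff it contains 0, the value of the empty rest. Only \<open>n \<le> x\<close>
  matter, so \<open>X\<close> may be truncated to \<open>Y\<close>. The injection \<open>e\<close>
  merely codes these sets as natural numbers.\<close>

lemma automaticity_le_card_residuals:
  assumes q: "q \<ge> 2" and Y: "Y = {n \<in> X. real n \<le> x}" and fin: "finite (residuals q Y)"
  shows "automaticity q X x \<le> card (residuals q Y)"
proof -
  let ?R = "residuals q Y"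
  define sh where "sh d S = {m. q * m + d \<in> S}" for d and S :: "nat set"
  obtain e :: "nat set \<Rightarrow> nat" where e: "inj_on e ?R"
    using finite_imp_inj_to_nat_seg[OF fin] by blast
  define M :: "(nat, nat) automaton" where
    "M = \<lparr>states = e ` ?R, start = e Y, trans = (\<lambda>d s. e (sh d (inv_into ?R e s))),
      accepting = e ` {S \<in> ?R. 0 \<in> S}\<rparr>"
  have sh: "sh d S \<in> ?R" if "S \<in> ?R" "d < q" for d S
    using shift_mem_residuals[OF that] by (simp add: sh_def)
  have run: "fold (trans M) w (e S) = e (fold sh w S) \<and> fold sh w S \<in> ?R"
    if "set w \<subseteq> {..<q}" "S \<in> ?R" for w S
    using that
  proof (induction w arbitrary: S)
    case (Cons d w)
    then show ?case
      using sh[of S d] by (auto simp: M_def inv_into_f_f[OF e])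
  qed auto
  have "finite_automaton {..<q} M"
    using fin mem_residuals sh by (auto simp: finite_automaton_def M_def inv_into_f_f[OF e])
  moreover have "accepts M (base_rep q n) \<longleftrightarrow> n \<in> X" if "real n \<le> x" for n
  proof -
    let ?S = "fold sh (base_rep q n) Y"
    have S: "fold (trans M) (base_rep q n) (e Y) = e ?S" "?S \<in> ?R"
      using run[OF set_base_rep mem_residuals] by auto
    have "accepts M (base_rep q n) \<longleftrightarrow> e ?S \<in> e ` {S \<in> ?R. 0 \<in> S}"
      using S(1) by (simp add: accepts_def M_def)
    also have "\<dots> \<longleftrightarrow> 0 \<in> ?S"
      using S(2) e by (auto dest: inj_onD)
    also have "\<dots> \<longleftrightarrow> n \<in> Y"
      using zero_mem_fold_shift[of q "base_rep q n" Y] horner_sum_base_rep[OF q, of n]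
      by (simp add: sh_def[abs_def])
    finally show ?thesis
      using that Y by simp
  qed
  ultimately have "recognizes_upto q X x M"
    by (simp add: recognizes_upto_def)
  moreover have "card (states M) = card ?R"
    using e by (simp add: M_def card_image)
  ultimately show ?thesis
    unfolding automaticity_def by (intro Least_le) blast
qed

section \<open>A Mertens-type bound for the totient\<close>

text \<open>A truncated Euler product, by adding one prime \<open>p\<close> at a time: an admissible
  \<open>n\<close> either avoids \<open>p\<close> or is \<open>p\<close> times an admissible number,
  so the new sum \<open>G'\<close> and the old sum \<open>G\<close> satisfy
  \<open>G' \<le> G + G' / p\<close>. Truncation at \<open>N\<close> keeps all sums finite.\<close>

lemma sum_inverse_smooth_times_prod_le:
  fixes Q :: "nat set"
  assumes "finite Q" "\<And>p. p \<in> Q \<Longrightarrow> prime p"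
  shows "(\<Sum>n | n \<in> {1..N} \<and> prime_factors n \<subseteq> Q. 1 / real n) * (\<Prod>p\<in>Q. 1 - 1 / real p) \<le> 1"
  using assms
proof (induction Q rule: finite_induct)
  case empty
  have "{n. n \<in> {1..N} \<and> prime_factors n \<subseteq> {}} \<subseteq> {1}"
    by (auto simp: prime_factorization_empty_iff)
  then have "(\<Sum>n | n \<in> {1..N} \<and> prime_factors n \<subseteq> {}. 1 / real n) \<le> (\<Sum>n\<in>{1}. 1 / real n)"
    by (intro sum_mono2) auto
  then show ?case by simp
next
  case (insert p Q)
  let ?A = "\<lambda>Q. {n. n \<in> {1..N} \<and> prime_factors n \<subseteq> Q}"
  let ?G = "\<lambda>Q. \<Sum>n\<in>?A Q. 1 / real n"
  have p: "prime p" using insert.prems by simp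
  have le: "1 / real n \<le> 1" for n by (cases n) auto
  have sub: "?A (insert p Q) \<subseteq> ?A Q \<union> (\<lambda>n. p * n) ` ?A (insert p Q)"
  proof
    fix n assume n: "n \<in> ?A (insert p Q)"
    show "n \<in> ?A Q \<union> (\<lambda>n. p * n) ` ?A (insert p Q)"
    proof (cases "p dvd n")
      case False
      then have "p \<notin> prime_factors n" by auto
      then show ?thesis using n by blast
    next
      case True
      then obtain m where m: "n = p * m" by blast
      have "m \<ge> 1" "m \<le> n" using n m p by (auto simp: prime_gt_0_nat Suc_le_eq)
      moreover have "prime_factors m \<subseteq> prime_factors n"
        using m n by (intro dvd_prime_factors) auto
      ultimately have "m \<in> ?A (insert p Q)" using n by force
      then show ?thesis using m by blast
    qed
  qed
  have "?G (insert p Q) \<le> (\<Sum>n\<in>?A Q \<union> (\<lambda>n. p * n) ` ?A (insert p Q). 1 / real n)"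
    by (intro sum_mono2[OF _ sub]) auto
  also have "\<dots> \<le> ?G Q + (\<Sum>n\<in>(\<lambda>n. p * n) ` ?A (insert p Q). 1 / real n)"
    by (subst sum_Un) (auto intro!: sum_nonneg)
  also have "(\<Sum>n\<in>(\<lambda>n. p * n) ` ?A (insert p Q). 1 / real n) = ?G (insert p Q) / real p"
    using prime_gt_0_nat[OF p]
    by (subst sum.reindex) (auto simp: inj_on_def sum_divide_distrib field_simps)
  finally have "?G (insert p Q) * (1 - 1 / real p) \<le> ?G Q"
    by (simp add: field_simps)
  then have "?G (insert p Q) * (1 - 1 / real p) * (\<Prod>p\<in>Q. 1 - 1 / real p)
      \<le> ?G Q * (\<Prod>p\<in>Q. 1 - 1 / real p)"
    by (intro mult_right_mono prod_nonneg) (auto simp: le)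
  also have "\<dots> \<le> 1" using insert by simp
  finally show ?case using insert by (simp add: mult.assoc)
qed

text \<open>By Euler's formula \<open>totient n / n\<close> is the product of
  \<open>1 - 1 / p\<close> over the primes dividing \<open>n\<close>. Every \<open>m \<le> y\<close>
  has only such prime factors, so the sum over smooth numbers contains the harmonic sum up to
  \<open>y\<close>, which is at least \<open>ln (y + 1)\<close>.\<close>

lemma totient_times_ln_le:
  assumes n: "n > 0" and dvd: "\<And>p. prime p \<Longrightarrow> p \<le> y \<Longrightarrow> p dvd n"
  shows "real (totient n) * ln (real y + 1) \<le> real n"
proof -
  let ?Q = "prime_factors n"
  have sub: "{1..y} \<subseteq> {m. m \<in> {1..y} \<and> prime_factors m \<subseteq> ?Q}"
  proof safe
    fix m p assume m: "m \<in> {1..y}" "p \<in> prime_factors m"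
    then have "p \<le> y" using dvd_imp_le[of p m] by force
    then show "p \<in> ?Q" using m dvd[of p] n by (auto simp: in_prime_factors_iff)
  qed
  have "ln (real y + 1) \<le> (\<Sum>m\<in>{1..y}. 1 / real m)"
    using ln_le_harm[of y] by (simp add: harm_def inverse_eq_divide)
  also have "\<dots> \<le> (\<Sum>m | m \<in> {1..y} \<and> prime_factors m \<subseteq> ?Q. 1 / real m)"
    by (intro sum_mono2[OF _ sub]) auto
  finally have "ln (real y + 1) * (\<Prod>p\<in>?Q. 1 - 1 / real p)
      \<le> (\<Sum>m | m \<in> {1..y} \<and> prime_factors m \<subseteq> ?Q. 1 / real m) * (\<Prod>p\<in>?Q. 1 - 1 / real p)"
    by (intro mult_right_mono prod_nonneg)
       (auto dest!: in_prime_factors_imp_prime prime_gt_0_nat simp: field_simps Suc_le_eq)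
  also have "\<dots> \<le> 1"
    by (intro sum_inverse_smooth_times_prod_le) auto
  finally show ?thesis
    using n by (simp add: totient_formula2 field_simps)
qed

section \<open>Integers coprime to a modulus in an interval\<close>

text \<open>The \<open>K\<close> consecutive integers from \<open>u\<close> on meet at most
  \<open>K div P + 2\<close> blocks of length \<open>P\<close>, the 2 allowing for incomplete blocks
  at both ends. Each block has at most \<open>totient P\<close> integers coprime to
  \<open>P\<close>.\<close>

lemma card_coprime_interval_le:
  assumes P: "P > 0"
  shows "card {m. m < K \<and> coprime (m + u) P} \<le> (K div P + 2) * totient P"
proof -
  let ?r = "{r. r < P \<and> coprime r P}"
  have r: "card ?r \<le> totient P"
  \<comment> \<open>Remainders start at 0 but totatives at 1. This matters only for
    \<open>P = 1\<close>, where the remainder 0 takes the place of the totative 1.\<close>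
  proof (cases "P = 1")
    case False
    then have "?r \<subseteq> totatives P"
      using P by (auto simp: totatives_def intro!: Nat.gr0I)
    then show ?thesis unfolding totient_def by (intro card_mono) auto
  qed auto
  have "K + u \<le> (K div P + 1) * P + (u div P + 1) * P"
    using div_mult_mod_eq[of K P] div_mult_mod_eq[of u P] mod_less_divisor[OF P, of K]
      mod_less_divisor[OF P, of u] unfolding add_mult_distrib mult_1 by linarith
  then have K: "m + u < (u div P + (K div P + 2)) * P" if "m < K" for m
    using that by (simp add: algebra_simps)
  let ?f = "\<lambda>m. ((m + u) div P, (m + u) mod P)"
  have "inj_on ?f {m. m < K \<and> coprime (m + u) P}"
    by (intro inj_onI) (metis add_right_cancel div_mult_mod_eq prod.inject)
  moreover have "?f ` {m. m < K \<and> coprime (m + u) P}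
      \<subseteq> {u div P..<u div P + (K div P + 2)} \<times> ?r"
    using P K by (auto simp: div_le_mono div_less_iff_less_mult)
  ultimately have "card {m. m < K \<and> coprime (m + u) P}
      \<le> card ({u div P..<u div P + (K div P + 2)} \<times> ?r)"
    by (intro card_inj_on_le) auto
  also have "\<dots> \<le> (K div P + 2) * totient P"
    using mult_le_mono2[OF r, of "K div P + 2"] by (simp add: card_cartesian_product)
  finally show ?thesis .
qed

section \<open>Counting residuals at low and high levels\<close>

text \<open>Level \<open>k\<close> gives at most \<open>q ^ k\<close> residuals, one for each
  \<open>a\<close>. As \<open>q \<ge> 2\<close>, the geometric sum is at most twice its last term,
  which is at most \<open>D\<close>.\<close>

lemma card_low_residuals_le:
  assumes q: "q \<ge> 2" and D: "D \<ge> 1"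
  shows "finite {residual q Y a k |a k. a < q ^ k \<and> real (q ^ k) \<le> D}" (is "finite ?R")
    and "real (card {residual q Y a k |a k. a < q ^ k \<and> real (q ^ k) \<le> D}) \<le> 2 * D"
proof -
  let ?K = "{k. real (q ^ k) \<le> D}"
  have "?K \<subseteq> {..nat \<lfloor>D\<rfloor>}"
  proof safe
    fix k assume "real (q ^ k) \<le> D"
    moreover have "k \<le> q ^ k"
      using q by (intro less_imp_le power_gt_expt) auto
    then have "real k \<le> real (q ^ k)" by (rule of_nat_mono)
    ultimately show "k \<le> nat \<lfloor>D\<rfloor>"
      by (intro le_nat_floor) linarith
  qed
  then have fin: "finite ?K" by (rule finite_subset) simp
  \<comment> \<open>Level 0 is always low because \<open>D \<ge> 1\<close>, so \<open>Max ?K\<close>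
    is a genuine maximum.\<close>
  have ne: "?K \<noteq> {}" using D by (auto intro!: exI[of _ 0])
  have sub: "?R \<subseteq> (\<Union>k\<le>Max ?K. (\<lambda>a. residual q Y a k) ` {..<q ^ k})"
    using Max_ge[OF fin] by blast
  show "finite ?R" by (rule finite_subset[OF sub]) simp
  have geom: "(\<Sum>k\<le>n. q ^ k) \<le> 2 * q ^ n" for n
  proof (induction n)
    case (Suc n)
    have "2 * q ^ n \<le> q * q ^ n" using q by (intro mult_right_mono) auto
    then show ?case using Suc by (simp only: sum.atMost_Suc power_Suc)
  qed simp
  have "card ?R \<le> card (\<Union>k\<le>Max ?K. (\<lambda>a. residual q Y a k) ` {..<q ^ k})"
    by (intro card_mono sub) auto
  also have "\<dots> \<le> (\<Sum>k\<le>Max ?K. card ((\<lambda>a. residual q Y a k) ` {..<q ^ k}))"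
    by (intro card_UN_le) auto
  also have "\<dots> \<le> (\<Sum>k\<le>Max ?K. q ^ k)"
    using card_image_le[OF finite_lessThan] by (intro sum_mono) fastforce
  also have "\<dots> \<le> 2 * q ^ Max ?K" by (rule geom)
  finally have card: "card ?R \<le> 2 * q ^ Max ?K" .
  have "real (q ^ Max ?K) \<le> D"
    using Max_in[OF fin ne] by simp
  then have "real (2 * q ^ Max ?K) \<le> 2 * D" by simp
  then show "real (card ?R) \<le> 2 * D"
    by (rule order.trans[OF of_nat_mono[OF card]])
qed

text \<open>Let \<open>t\<close> be the inverse of \<open>q ^ k\<close> modulo \<open>P\<close>.
  Multiplication by \<open>t\<close> turns \<open>a + q ^ k * m\<close> into
  \<open>m + t * a\<close> modulo \<open>P\<close> and preserves coprimality to \<open>P\<close>, so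
  \<open>u = t * a mod P\<close> works for all \<open>m\<close> at once.\<close>

lemma residual_subset_coprime:
  assumes q: "coprime P q" and P: "P > 0" and D: "D > 0" "real (q ^ k) > D"
    and Y: "\<And>n. n \<in> Y \<Longrightarrow> real n \<le> x" "\<And>n. n \<in> Y \<Longrightarrow> real n > D \<Longrightarrow> coprime n P"
  shows "\<exists>u<P. residual q Y a k \<subseteq> insert 0 {m. m < nat \<lfloor>x / D\<rfloor> + 1 \<and> coprime (m + u) P}"
proof -
  have "coprime (q ^ k) P" using q by (simp add: coprime_commute)
  from cong_solve_coprime_nat[OF this] obtain t where t: "[q ^ k * t = 1] (mod P)"
    by auto
  have cop: "coprime t P"
    using t by (metis cong_imp_coprime cong_sym coprime_1_left coprime_mult_left_iff)
  \<comment> \<open>The case \<open>m = 0\<close> is set apart: the element \<open>a\<close> itself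
    may be at most \<open>D\<close> and then need not be coprime to \<open>P\<close>. For
    \<open>m \<ge> 1\<close> the element is at least \<open>q ^ k > D\<close>.\<close>
  have "m < nat \<lfloor>x / D\<rfloor> + 1 \<and> coprime (m + t * a mod P) P"
    if m: "m \<in> residual q Y a k" "m \<noteq> 0" for m
  proof
    have n: "a + q ^ k * m \<in> Y" using m by (simp add: residual_def)
    have ge: "D * real m \<le> real (a + q ^ k * m)"
      using mult_right_mono[of D "real (q ^ k)" "real m"] D by simp
    then have "real m \<le> x / D"
      using Y(1)[OF n] D by (simp add: field_simps)
    then show "m < nat \<lfloor>x / D\<rfloor> + 1"
      using le_nat_floor by (simp add: less_Suc_eq_le)
    have "q ^ k \<le> a + q ^ k * m" using m by (cases m) auto
    then have "real (q ^ k) \<le> real (a + q ^ k * m)" using of_nat_le_iff by blast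
    then have "coprime (a + q ^ k * m) P"
      using D(2) Y(2)[OF n] by linarith
    then have "coprime (t * (a + q ^ k * m)) P" using cop by simp
    moreover have "[t * (a + q ^ k * m) = m + t * a mod P] (mod P)"
    proof -
      have "[t * a + (q ^ k * t) * m = t * a mod P + 1 * m] (mod P)"
        by (intro cong_add cong_mult t cong_refl) (simp add: cong_def)
      then show ?thesis by (simp add: algebra_simps)
    qed
    ultimately show "coprime (m + t * a mod P) P"
      by (rule cong_imp_coprime[rotated])
  qed
  then show ?thesis using P by (intro exI[of _ "t * a mod P"]) auto
qed

text \<open>The covering sets depend on the shift \<open>u\<close> alone, not on \<open>k\<close>,
  so all high levels are counted together and their number does not enter. The \<open>+ 1\<close> in
  the exponent pays for the element 0.\<close>

lemma card_high_residuals_le: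
  fixes x D :: real
  defines "K \<equiv> nat \<lfloor>x / D\<rfloor> + 1"
  assumes q: "coprime P q" and P: "P > 0" and D: "D > 0"
    and Y: "\<And>n. n \<in> Y \<Longrightarrow> real n \<le> x" "\<And>n. n \<in> Y \<Longrightarrow> real n > D \<Longrightarrow> coprime n P"
  shows "finite {residual q Y a k |a k. a < q ^ k \<and> real (q ^ k) > D}" (is "finite ?R")
    and "card {residual q Y a k |a k. a < q ^ k \<and> real (q ^ k) > D}
      \<le> P * 2 ^ ((K div P + 2) * totient P + 1)"
proof -
  let ?C = "\<lambda>u. insert 0 {m. m < K \<and> coprime (m + u) P}"
  have sub: "?R \<subseteq> (\<Union>u<P. Pow (?C u))"
  proof
    fix S assume "S \<in> ?R"
    then obtain a k where S: "S = residual q Y a k" "real (q ^ k) > D" by blast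
    then obtain u where "u < P" "S \<subseteq> ?C u"
      using residual_subset_coprime[OF q P D S(2) Y] unfolding K_def by metis
    then show "S \<in> (\<Union>u<P. Pow (?C u))" by blast
  qed
  show "finite ?R" by (rule finite_subset[OF sub]) simp
  have "card ?R \<le> card (\<Union>u<P. Pow (?C u))"
    by (intro card_mono sub) simp
  also have "\<dots> \<le> (\<Sum>u<P. card (Pow (?C u)))"
    by (intro card_UN_le) auto
  also have "\<dots> \<le> (\<Sum>u<P. 2 ^ ((K div P + 2) * totient P + 1))"
  proof (intro sum_mono)
    fix u
    have "card (?C u) \<le> (K div P + 2) * totient P + 1"
      using card_coprime_interval_le[OF P, of K u] by (intro order.trans[OF card_insert_le_m1]) auto
    then have "(2::nat) ^ card (?C u) \<le> 2 ^ ((K div P + 2) * totient P + 1)"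
      by (rule power_increasing) simp
    then show "card (Pow (?C u)) \<le> 2 ^ ((K div P + 2) * totient P + 1)"
      by (subst card_Pow) auto
  qed
  finally show "card ?R \<le> P * 2 ^ ((K div P + 2) * totient P + 1)" by simp
qed

section \<open>The modulus built from small primes\<close>

definition prime_modulus :: "nat \<Rightarrow> nat \<Rightarrow> nat" where
  "prime_modulus q y = \<Prod>{p. prime p \<and> p \<le> y \<and> \<not> p dvd q}"

lemma finite_primes_le_not_dvd: "finite {p::nat. prime p \<and> p \<le> y \<and> \<not> p dvd q}"
  by (rule finite_subset[of _ "{..y}"]) auto

lemma prime_modulus_pos: "prime_modulus q y > 0"
  unfolding prime_modulus_def by (intro prod_pos) (auto simp: prime_gt_0_nat)

lemma coprime_prime_modulus: "coprime (prime_modulus q y) q"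
  unfolding prime_modulus_def by (intro prod_coprime_left) (auto intro: prime_imp_coprime)

lemma coprime_prime_modulus_of_prime:
  assumes "prime n" "y < n"
  shows "coprime n (prime_modulus q y)"
  unfolding prime_modulus_def using assms
  by (intro prod_coprime_right) (auto intro!: primes_coprime)

text \<open>There are at most \<open>y\<close> factors, each at most \<open>y\<close>. This crude
  bound suffices because \<open>y\<close> will be as small as
  \<open>sqrt (ln (ln x))\<close>.\<close>

lemma prime_modulus_le: "prime_modulus q y \<le> y ^ y"
proof -
  let ?Q = "{p. prime p \<and> p \<le> y \<and> \<not> p dvd q}"
  have "prime_modulus q y \<le> (\<Prod>p\<in>?Q. y)"
    unfolding prime_modulus_def by (intro prod_mono) auto
  also have "\<dots> = y ^ card ?Q" by simp
  also have "\<dots> \<le> y ^ y"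
  proof (cases "y = 0")
    case True
    then have Q: "?Q = {}" by (auto dest: prime_gt_0_nat)
    show ?thesis unfolding Q unfolding True by simp
  next
    case False
    have "card ?Q \<le> card {1..y}"
      by (intro card_mono) (auto simp: Suc_le_eq prime_gt_0_nat)
    then show ?thesis using False by (intro power_increasing) auto
  qed
  finally show ?thesis .
qed

text \<open>Multiplying by \<open>q\<close> restores the omitted primes, so the totient bound
  applies to the product of the modulus and \<open>q\<close>. The price is the factor
  \<open>q\<close>.\<close>

lemma totient_prime_modulus_le:
  assumes "q > 0"
  shows "real (totient (prime_modulus q y)) * ln (real y + 1) \<le> real q * real (prime_modulus q y)"
proof -
  let ?P = "prime_modulus q y"
  have "p dvd ?P * q" if "prime p" "p \<le> y" for p
  proof (cases "p dvd q")
    case False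
    then have "p dvd ?P"
      unfolding prime_modulus_def using that by (intro dvd_prodI[OF finite_primes_le_not_dvd]) auto
    then show ?thesis by simp
  qed simp
  then have "real (totient (?P * q)) * ln (real y + 1) \<le> real (?P * q)"
    using assms prime_modulus_pos by (intro totient_times_ln_le) auto
  moreover have "totient ?P \<le> totient (?P * q)"
    using assms prime_modulus_pos[of q y] by (intro totient_dvd_mono) auto
  then have "real (totient ?P) * ln (real y + 1) \<le> real (totient (?P * q)) * ln (real y + 1)"
    by (intro mult_right_mono of_nat_mono) auto
  ultimately show ?thesis by (simp add: mult.commute)
qed

section \<open>Combining the levels and choosing the parameters\<close>

lemma automaticity_primes_le:
  assumes q: "q \<ge> 2" and D: "D \<ge> 1" "real y \<le> D"
  defines "P \<equiv> prime_modulus q y"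
  shows "real (automaticity q {p. prime p} x)
    \<le> 2 * D + real (P * 2 ^ (((nat \<lfloor>x / D\<rfloor> + 1) div P + 2) * totient P + 1))"
proof -
  define Y where "Y = {n \<in> {p. prime p}. real n \<le> x}"
  let ?L = "{residual q Y a k |a k. a < q ^ k \<and> real (q ^ k) \<le> D}"
  let ?H = "{residual q Y a k |a k. a < q ^ k \<and> real (q ^ k) > D}"
  have R: "residuals q Y = ?L \<union> ?H"
  proof (intro equalityI subsetI)
    fix S assume "S \<in> residuals q Y"
    then obtain a k where "S = residual q Y a k" "a < q ^ k"
      by (auto simp: residuals_def)
    then show "S \<in> ?L \<union> ?H"
      by (cases "real (q ^ k) \<le> D") (blast, metis (mono_tags, lifting) UnI2 mem_Collect_eq not_le)
  qed (auto simp: residuals_def)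
  \<comment> \<open>A prime above \<open>D \<ge> y\<close> exceeds every prime factor of
    \<open>P\<close>.\<close>
  have cop: "coprime n P" if "n \<in> Y" "real n > D" for n
    unfolding P_def using that D by (intro coprime_prime_modulus_of_prime) (auto simp: Y_def)
  have le: "real n \<le> x" if "n \<in> Y" for n using that by (simp add: Y_def)
  have D0: "D > 0" using D by simp
  note low = card_low_residuals_le[OF q D(1), of Y]
  note high = card_high_residuals_le[OF coprime_prime_modulus prime_modulus_pos D0 le cop[unfolded P_def]]
  have "automaticity q {p. prime p} x \<le> card (residuals q Y)"
    using low(1) high(1) by (intro automaticity_le_card_residuals[OF q Y_def]) (simp add: R)
  also have "\<dots> \<le> card ?L + card ?H"
    unfolding R by (rule card_Un_le)
  finally have le_sum: "real (automaticity q {p. prime p} x) \<le> real (card ?L) + real (card ?H)"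
    unfolding of_nat_add[symmetric] of_nat_le_iff .
  have card_H: "real (card ?H) \<le> real (P * 2 ^ (((nat \<lfloor>x / D\<rfloor> + 1) div P + 2) * totient P + 1))"
    unfolding P_def by (intro of_nat_mono high(2))
  show ?thesis
    by (rule order.trans[OF le_sum add_mono[OF low(2) card_H]])
qed

text \<open>The constants keep the exponent \<open>e\<close> below \<open>L / 2\<close>: as
  \<open>totient P / P\<close> is at most \<open>2 * q / T\<close> and
  \<open>x / D = L * T / (16 * q)\<close>, the main term is \<open>L / 8\<close>, while
  \<open>T \<ge> 32 * q\<close> bounds the rounding terms by
  \<open>(1 + 2 * L) / 16\<close>.\<close>

lemma automaticity_primes_le_explicit:
  fixes q :: nat and x :: real
  defines "L \<equiv> ln x" and "T \<equiv> ln (ln (ln x))"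
  defines "D \<equiv> 16 * real q * x / (L * T)"
  assumes q: "q \<ge> 2" and x: "x > 0" and L: "L \<ge> 1" and T: "T \<ge> 32 * real q"
    and D: "D \<ge> 1" "D \<ge> sqrt (ln (ln x))"
  shows "real (automaticity q {p. prime p} x) \<le> 2 * D + 2 * L * sqrt x"
proof -
  \<comment> \<open>This size of \<open>z\<close> gives
    \<open>P \<le> y ^ y \<le> exp (z ^ 2) = L\<close> and still \<open>ln z = T / 2\<close>, so the
    sieve saves a factor of order \<open>T\<close>.\<close>
  define z where "z = sqrt (ln L)"
  define y where "y = nat \<lfloor>z\<rfloor>"
  define P where "P = prime_modulus q y"
  define K where "K = nat \<lfloor>x / D\<rfloor> + 1"
  have T0: "T > 0" using T q by linarith
  \<comment> \<open>For \<open>L = 1\<close> the value \<open>T\<close> would be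
    \<open>ln 0\<close>, which is 0 by convention, contradicting \<open>T0\<close>.\<close>
  have lnL: "ln L > 0"
    using T0 L by (cases "L = 1") (auto simp: T_def L_def)
  then have z: "z > 0" by (simp add: z_def)
  have y: "real y \<le> z" "z < real y + 1"
    unfolding y_def using z by linarith+
  have "T = 2 * ln z"
    using lnL by (simp add: z_def T_def L_def ln_sqrt)
  also have "ln z \<le> ln (real y + 1)" using y z by simp
  finally have lny: "T / 2 \<le> ln (real y + 1)" by simp
  have P0: "P > 0" unfolding P_def by (rule prime_modulus_pos)
  have "real P \<le> real y ^ y"
    unfolding P_def of_nat_power[symmetric] by (intro of_nat_mono prime_modulus_le)
  also have "\<dots> \<le> exp (real y) ^ y"
    by (intro power_mono) (use exp_ge_add_one_self[of "real y"] in linarith, simp)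
  also have "\<dots> = exp (real y ^ 2)"
    by (simp add: exp_of_nat_mult[symmetric] power2_eq_square)
  also have "\<dots> \<le> exp (z ^ 2)" using y by (simp add: power_mono)
  also have "\<dots> = L" using lnL L by (simp add: z_def)
  finally have PL: "real P \<le> L" .
  have "real (totient P) * (T / 2) \<le> real (totient P) * ln (real y + 1)"
    by (intro mult_left_mono lny) simp
  also have "\<dots> \<le> real q * real P"
    unfolding P_def using q by (intro totient_prime_modulus_le) simp
  finally have tot: "real (totient P) \<le> 2 * real q * real P / T"
    using T0 by (simp add: field_simps)
  have K: "real K \<le> L * T / (16 * real q) + 1"
  proof -
    have "x / D = L * T / (16 * real q)"
      using x q L T0 by (simp add: D_def)
    then show ?thesis
      using L T0 unfolding K_def by (simp add: of_nat_floor)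
  qed
  define e where "e = (K div P + 2) * totient P"
  have "real e \<le> (real K / real P + 2) * (2 * real q * real P / T)"
    unfolding e_def of_nat_mult using tot of_nat_div_le_of_nat[of K P, where 'a = real]
    by (intro mult_mono) auto
  also have "\<dots> = (real K + 2 * real P) * (2 * real q / T)"
    using P0 T0 by (simp add: field_simps)
  also have "\<dots> \<le> (L * T / (16 * real q) + 1 + 2 * L) * (2 * real q / T)"
    using K PL T0 by (intro mult_right_mono) auto
  also have "\<dots> = L / 8 + (1 + 2 * L) * (2 * real q / T)"
    using T0 q by (simp add: field_simps)
  also have "\<dots> \<le> L / 8 + (1 + 2 * L) * (1 / 16)"
    using T T0 L by (intro add_left_mono mult_left_mono) (auto simp: field_simps)
  also have "\<dots> \<le> L / 2" using L by (simp add: add_divide_distrib)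
  finally have e_le: "real e \<le> L / 2" .
  have "(2::real) ^ e \<le> exp 1 ^ e"
    using exp_ge_add_one_self[of 1] by (intro power_mono) auto
  also have "\<dots> = exp (real e)" using exp_of_nat_mult[of e "1::real"] by simp
  also have "\<dots> \<le> exp (L / 2)" using e_le by (simp only: exp_le_cancel_iff)
  also have "\<dots> = sqrt x"
    using x by (simp add: L_def ln_sqrt[symmetric])
  finally have pow: "(2::real) ^ e \<le> sqrt x" .
  have "real (P * 2 ^ (e + 1)) = 2 * (real P * 2 ^ e)" by simp
  also have "\<dots> \<le> 2 * (L * sqrt x)"
    using pow PL L by (intro mult_left_mono mult_mono) auto
  finally have "real (P * 2 ^ (e + 1)) \<le> 2 * L * sqrt x" by (simp only: mult.assoc)
  note bound = order.trans[OF _ add_left_mono[OF this]]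
  have "real y \<le> D" using y D(2) by (simp add: z_def L_def)
  from automaticity_primes_le[OF q D(1) this, of x] show ?thesis
    unfolding P_def[symmetric] K_def[symmetric] e_def[symmetric] by (rule bound)
qed

theorem theorem3:
  fixes q :: nat
  assumes "q \<ge> 2"
  shows "(\<lambda>x::real. real (automaticity q {p. prime p} x))
           \<in> O[at_top](\<lambda>x. x / (ln x * ln (ln (ln x))))"
proof (rule bigoI)
  let ?g = "\<lambda>x::real. x / (ln x * ln (ln (ln x)))"
  have g: "eventually (\<lambda>x. ?g x \<ge> 1) at_top" by real_asymp
  have g': "eventually (\<lambda>x. ?g x \<ge> sqrt (ln (ln x))) at_top" by real_asymp
  have err: "eventually (\<lambda>x. 2 * ln x * sqrt x \<le> ?g x) at_top" by real_asymp
  have L: "eventually (\<lambda>x::real. ln x \<ge> 1) at_top" by real_asymp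
  have "filterlim (\<lambda>x::real. ln (ln (ln x))) at_top at_top" by real_asymp
  then have T: "eventually (\<lambda>x::real. ln (ln (ln x)) \<ge> 32 * real q) at_top"
    by (simp add: filterlim_at_top)
  \<comment> \<open>The constant consists of \<open>2 * 16 * q\<close> from the term
    \<open>2 * D\<close> and 1 from the high levels, absorbed by \<open>err\<close>.\<close>
  show "eventually (\<lambda>x. norm (real (automaticity q {p. prime p} x))
      \<le> (32 * real q + 1) * norm (?g x)) at_top"
    using g g' err L T eventually_gt_at_top[of 0]
  proof eventually_elim
    case (elim x)
    \<comment> \<open>Here \<open>D\<close> is \<open>16 * q\<close> times \<open>?g x\<close>, so
      it inherits both lower bounds required of \<open>D\<close> from \<open>g\<close> and
      \<open>g'\<close>.\<close>
    have "?g x * 1 \<le> ?g x * (16 * real q)"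
      using assms elim by (intro mult_left_mono) auto
    then have "real (automaticity q {p. prime p} x)
        \<le> 2 * (16 * real q * x / (ln x * ln (ln (ln x)))) + 2 * ln x * sqrt x"
      using elim assms by (intro automaticity_primes_le_explicit) (auto simp: mult_ac)
    also have "\<dots> \<le> (32 * real q + 1) * ?g x"
      using elim(3) by (simp add: algebra_simps)
    also have "\<dots> = (32 * real q + 1) * norm (?g x)"
      using elim(1) by (simp only: real_norm_def abs_of_pos)
    finally show ?case by simp
  qed
qed

end
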